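(* Let $G$ and $H$ be finite graphs with $\chi(G) > 2$, let $\phi : H \rightarrow G$ be a graph homomorphism, and let $r \in \mathbb{N}$ be such that $|\phi(N(v))| \leq r$ for every $v \in V(H)$. Then $\chi(H) \leq \lceil r\, 2^r \log\log \chi(G) \rceil$.
   Context: Graphs are simple (no loops). For a vertex $v$, $N(v)$ is the set of neighbours of $v$ (excluding $v$), and for a set $X$ of vertices, $\phi(X) = \{\phi(x) : x \in X\}$. A graph homomorphism $\phi: H \to G$ is a map $V(H) \to V(G)$ sending edges to edges. $\chi$ denotes the chromatic number and $\log$ is the base-2 logarithm. *)

theory Defs
  imports Complex_Main "Graph_Theory.Pair_Digraph"
begin

text \<open>
  A finite simple graph is a \<^locale>\<open>pair_graph\<close>: a finite vertex set together with a
  finite, symmetric, irreflexive set of arcs, where an undirected edge between \<open>u\<close> and \<open>v\<close>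
  is the pair of arcs \<open>(u, v)\<close> and \<open>(v, u)\<close>.
\<close>

definition neighbours :: "'a pair_pre_digraph \<Rightarrow> 'a \<Rightarrow> 'a set" where
  "neighbours G v = {w. (v, w) \<in> parcs G}"

definition graph_hom :: "'a pair_pre_digraph \<Rightarrow> 'b pair_pre_digraph \<Rightarrow> ('a \<Rightarrow> 'b) \<Rightarrow> bool" where
  "graph_hom H G \<phi> \<longleftrightarrow>
     (\<forall>v \<in> pverts H. \<phi> v \<in> pverts G) \<and>
     (\<forall>u v. (u, v) \<in> parcs H \<longrightarrow> (\<phi> u, \<phi> v) \<in> parcs G)"

definition proper_colouring :: "'a pair_pre_digraph \<Rightarrow> nat \<Rightarrow> ('a \<Rightarrow> nat) \<Rightarrow> bool" where
  "proper_colouring G k c \<longleftrightarrow>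
     (\<forall>v \<in> pverts G. c v < k) \<and> (\<forall>u v. (u, v) \<in> parcs G \<longrightarrow> c u \<noteq> c v)"

text \<open>
  A finite loop-free graph has a proper colouring with as many colours as vertices, so on a
  \<^locale>\<open>pair_graph\<close> the minimum below is attained.
\<close>

definition chromatic_number :: "'a pair_pre_digraph \<Rightarrow> nat" where
  "chromatic_number G = (LEAST k. \<exists>c. proper_colouring G k c)"

end

theory Submission
  imports Defs "HOL-Analysis.Harmonic_Numbers"
begin

text \<open>
  Composing \<open>\<phi>\<close> with an optimal colouring of \<open>G\<close> gives a proper colouring \<open>c\<close> of \<open>H\<close> with
  \<open>n = \<chi>(G) \<le> 2 ^ m\<close> colours in which every vertex sees at most \<open>r\<close> colours. Let \<open>X\<^sub>i\<close>, \<open>i < t\<close>,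
  be subsets of \<open>{..<m}\<close> inducing all \<open>2 ^ r\<close> traces on every \<open>r\<close>-element subset; a union bound
  gives such a family as soon as \<open>(m choose r) * 2 ^ r * (1 - 2 powr -r) ^ t < 1\<close>. Recolour a
  vertex \<open>v\<close> by an \<open>i\<close> such that \<open>X\<^sub>i\<close> agrees with the binary expansion of \<open>c v\<close> at the first
  position where \<open>c v\<close> differs from \<open>c w\<close>, for all neighbours \<open>w\<close>. Adjacent vertices share this
  position but have different bits there, so they get different \<open>i\<close>. For \<open>n \<le> 8\<close> or
  \<open>n \<le> 2 ^ r\<close> the colouring \<open>c\<close> itself is good enough, and for \<open>r = 1\<close> two colours suffice.
\<close>

section \<open>Independent families of sets, by counting\<close>

lemma card_subsets_trace:
  assumes "finite M" "S \<subseteq> M" "P \<subseteq> S"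
  shows "card {Y \<in> Pow M. Y \<inter> S = P} = 2 ^ (card M - card S)"
proof -
  have "bij_betw (\<lambda>Z. P \<union> Z) (Pow (M - S)) {Y \<in> Pow M. Y \<inter> S = P}"
    by (rule bij_betwI[where g = "\<lambda>Y. Y - S"]) (use assms in auto)
  then have "card {Y \<in> Pow M. Y \<inter> S = P} = card (Pow (M - S))"
    by (simp add: bij_betw_same_card)
  also have "\<dots> = 2 ^ (card M - card S)"
    using assms by (simp add: card_Pow card_Diff_subset finite_subset)
  finally show ?thesis .
qed

text \<open>The union bound is carried out by counting: of the \<open>(2 ^ m) ^ t\<close> tuples of
  subsets of \<open>{..<m}\<close>, a fraction \<open>(1 - 1 / 2 ^ r) ^ t\<close> misses a given
  trace \<open>P\<close> on \<open>S\<close>, and there are \<open>(m choose r) * 2 ^ r\<close>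
  pairs \<open>(S, P)\<close>. If these fractions sum to less than 1, some tuple misses no
  trace.\<close>

lemma ex_independent_family_exact:
  fixes m r t :: nat
  assumes "r \<le> m" and less: "real (m choose r) * 2 ^ r * (1 - 1 / 2 ^ r) ^ t < 1"
  shows "\<exists>X :: nat \<Rightarrow> nat set. \<forall>S P. S \<subseteq> {..<m} \<and> card S = r \<and> P \<subseteq> S \<longrightarrow>
           (\<exists>i<t. X i \<inter> S = P)"
proof (rule ccontr)
  assume none: "\<not> ?thesis"
  let ?M = "{..<m}"
  let ?I = "SIGMA S:{S. S \<subseteq> ?M \<and> card S = r}. Pow S"
  \<comment> \<open>Extensional functions on \<open>{..<t}\<close> stand for tuples, so that they
    form a finite set with a product cardinality.\<close>
  define bad where "bad = (\<lambda>(S, P). {..<t} \<rightarrow>\<^sub>E {Y \<in> Pow ?M. Y \<inter> S \<noteq> P})"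
  have fin: "finite {S. S \<subseteq> ?M \<and> card S = r}"
    by (rule finite_subset[of _ "Pow ?M"]) auto
  have finS: "finite (Pow S)" if "S \<in> {S. S \<subseteq> ?M \<and> card S = r}" for S
    using that by (auto intro: finite_subset)
  have finI: "finite ?I"
    using fin finS by (rule finite_SigmaI)
  have cardI: "card ?I = (m choose r) * 2 ^ r"
  proof -
    have "card ?I = (\<Sum>S\<in>{S. S \<subseteq> ?M \<and> card S = r}. card (Pow S))"
      using fin finS by (simp add: card_SigmaI)
    also have "\<dots> = (\<Sum>S\<in>{S. S \<subseteq> ?M \<and> card S = r}. 2 ^ r)"
      by (intro sum.cong refl) (auto simp: card_Pow finite_subset)
    also have "\<dots> = (m choose r) * 2 ^ r"
      using n_subsets[of ?M r] by simp
    finally show ?thesis .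
  qed
  have card_bad: "real (card (bad p)) = ((1 - 1 / 2 ^ r) * 2 ^ m) ^ t" if p_in: "p \<in> ?I" for p
  proof -
    obtain S P where p: "p = (S, P)" and S: "S \<subseteq> ?M" "card S = r" "P \<subseteq> S"
      using p_in by auto
    have "{Y \<in> Pow ?M. Y \<inter> S \<noteq> P} = Pow ?M - {Y \<in> Pow ?M. Y \<inter> S = P}"
      by auto
    then have "card {Y \<in> Pow ?M. Y \<inter> S \<noteq> P} = card (Pow ?M) - card {Y \<in> Pow ?M. Y \<inter> S = P}"
      by (simp only:) (rule card_Diff_subset, auto)
    then have "card {Y \<in> Pow ?M. Y \<inter> S \<noteq> P} = 2 ^ m - 2 ^ (m - r)"
      using card_subsets_trace[of ?M S P] S by (simp add: card_Pow del: Pow_iff)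
    moreover have "(2::nat) ^ (m - r) \<le> 2 ^ m"
      by (intro power_increasing) auto
    ultimately have "real (card {Y \<in> Pow ?M. Y \<inter> S \<noteq> P}) = 2 ^ m - 2 ^ (m - r)"
      by (simp only: of_nat_diff of_nat_power of_nat_numeral)
    also have "(2::real) ^ (m - r) = 2 ^ m / 2 ^ r"
      using \<open>r \<le> m\<close> by (intro power_diff) auto
    finally have "real (card {Y \<in> Pow ?M. Y \<inter> S \<noteq> P}) = (1 - 1 / 2 ^ r) * 2 ^ m"
      by (simp only: left_diff_distrib) simp
    moreover have "card (bad p) = card {Y \<in> Pow ?M. Y \<inter> S \<noteq> P} ^ t"
      unfolding p bad_def by (simp only: prod.case) (simp add: card_PiE)
    ultimately show ?thesis
      by simp
  qed
  have "({..<t} \<rightarrow>\<^sub>E Pow ?M) \<subseteq> (\<Union>p\<in>?I. bad p)"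
  proof
    fix X assume X: "X \<in> {..<t} \<rightarrow>\<^sub>E Pow ?M"
    from none obtain S P where SP: "S \<subseteq> ?M" "card S = r" "P \<subseteq> S" "\<forall>i<t. X i \<inter> S \<noteq> P"
      unfolding not_ex not_all not_imp by (elim allE[of _ X] exE conjE) auto
    with X have "X \<in> bad (S, P)"
      by (simp add: bad_def PiE_iff)
    moreover have "(S, P) \<in> ?I"
      using SP by simp
    ultimately show "X \<in> (\<Union>p\<in>?I. bad p)"
      by blast
  qed
  moreover have "finite (\<Union>p\<in>?I. bad p)"
    using finI by (rule finite_UN_I) (auto simp: bad_def intro!: finite_PiE)
  ultimately have "card ({..<t} \<rightarrow>\<^sub>E Pow ?M) \<le> card (\<Union>p\<in>?I. bad p)"
    by (simp add: card_mono)
  also have "\<dots> \<le> (\<Sum>p\<in>?I. card (bad p))"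
    using finI by (rule card_UN_le)
  finally have "real (card ({..<t} \<rightarrow>\<^sub>E Pow ?M)) \<le> (\<Sum>p\<in>?I. real (card (bad p)))"
    by (simp flip: of_nat_sum)
  also have "\<dots> = real (m choose r) * 2 ^ r * (1 - 1 / 2 ^ r) ^ t * (2 ^ m) ^ t"
    using card_bad cardI by (simp add: power_mult_distrib)
  also have "\<dots> < 1 * (2 ^ m) ^ t"
    using less by (intro mult_strict_right_mono) auto
  finally show False
    by (simp add: card_PiE card_Pow)
qed

text \<open>A set with fewer than \<open>r\<close> elements is enlarged inside \<open>{..<m}\<close>
  to one with exactly \<open>r\<close>. The predicate \<open>p\<close> will be the bits of a
  colour.\<close>

lemma ex_independent_family:
  fixes m r t :: nat
  assumes "r \<le> m" and "real (m choose r) * 2 ^ r * (1 - 1 / 2 ^ r) ^ t < 1"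
  obtains X :: "nat \<Rightarrow> nat set"
    where "\<And>S p. S \<subseteq> {..<m} \<Longrightarrow> card S \<le> r \<Longrightarrow> \<exists>i<t. \<forall>j\<in>S. j \<in> X i \<longleftrightarrow> p j"
proof -
  obtain X :: "nat \<Rightarrow> nat set"
    where X: "\<And>S P. S \<subseteq> {..<m} \<Longrightarrow> card S = r \<Longrightarrow> P \<subseteq> S \<Longrightarrow> \<exists>i<t. X i \<inter> S = P"
    using ex_independent_family_exact[OF assms] by blast
  show thesis
  proof (rule that[of X])
    fix S :: "nat set" and p assume S: "S \<subseteq> {..<m}" "card S \<le> r"
    then obtain T where T: "S \<subseteq> T" "T \<subseteq> {..<m}" "card T = r"
      using exists_subset_between[of S r "{..<m}"] \<open>r \<le> m\<close> by auto
    obtain i where "i < t" "X i \<inter> T = {j \<in> T. p j}"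
      using X[of T "{j \<in> T. p j}"] T by auto
    with T(1) show "\<exists>i<t. \<forall>j\<in>S. j \<in> X i \<longleftrightarrow> p j"
      by blast
  qed
qed

section \<open>First differing bits\<close>

definition first_diff :: "nat \<Rightarrow> nat \<Rightarrow> nat" where
  "first_diff x y = (LEAST j. bit x j \<noteq> bit y j)"

lemma first_diff_commute: "first_diff x y = first_diff y x"
  unfolding first_diff_def by (rule arg_cong[of _ _ Least]) auto

lemma bit_first_diff: "x \<noteq> y \<Longrightarrow> bit x (first_diff x y) \<noteq> bit y (first_diff x y)"
  unfolding first_diff_def by (rule LeastI_ex) (auto simp: bit_eq_iff)

lemma first_diff_less:
  assumes "x \<noteq> y" "x < 2 ^ m" "y < 2 ^ m"
  shows "first_diff x y < m"
proof -
  have "\<not> bit z j" if "z < 2 ^ m" "m \<le> j" for z j :: nat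
    using that by (metis bit_take_bit_iff leD take_bit_nat_eq_self)
  with bit_first_diff[OF assms(1)] assms(2,3) show ?thesis
    by (metis not_le)
qed

section \<open>Recolouring a graph whose neighbourhoods see few colours\<close>

context pair_graph
begin

lemma finite_neighbours: "finite (neighbours G v)"
proof -
  have "neighbours G v \<subseteq> pverts G"
    by (auto simp: neighbours_def dest: in_arcsD2)
  then show ?thesis
    using finite_verts by (rule finite_subset)
qed

lemma ex_colouring_chromatic_number: "\<exists>c. proper_colouring G (chromatic_number G) c"
proof -
  obtain f where "bij_betw f (pverts G) {0..<card (pverts G)}"
    using ex_bij_betw_finite_nat[of "pverts G"] finite_verts by auto
  then have f: "inj_on f (pverts G)" "f ` pverts G = {0..<card (pverts G)}"
    by (auto simp: bij_betw_def)
  have "proper_colouring G (card (pverts G)) f"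
    unfolding proper_colouring_def
  proof (intro conjI ballI allI impI)
    fix v assume "v \<in> pverts G"
    then show "f v < card (pverts G)"
      using f(2) by fastforce
  next
    fix u v assume "(u, v) \<in> parcs G"
    then show "f u \<noteq> f v"
      using f(1) by (metis inj_onD no_loops' in_arcsD1 in_arcsD2)
  qed
  then have "\<exists>k c. proper_colouring G k c"
    by blast
  then show ?thesis
    unfolding chromatic_number_def by (rule LeastI_ex)
qed

text \<open>On an edge with \<open>c u < c v\<close>, the neighbour \<open>u\<close> makes
  \<open>v\<close> receive 1, while all neighbours of \<open>u\<close> share the colour
  \<open>c v\<close>, which exceeds \<open>c u\<close>, so \<open>u\<close> receives 0.\<close>

lemma locally_one_colour_imp_2_colourable:
  assumes "proper_colouring G n c" and one: "\<forall>v\<in>pverts G. card (c ` neighbours G v) \<le> 1"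
  shows "\<exists>c'. proper_colouring G 2 c'"
proof -
  define c' where "c' v = (if \<exists>w\<in>neighbours G v. c w < c v then 1 else 0 :: nat)" for v
  have main: "c' u \<noteq> c' v" if uv: "(u, v) \<in> parcs G" and lt: "c u < c v" for u v
  proof -
    have "u \<in> neighbours G v" "v \<in> neighbours G u"
      using uv by (auto simp: neighbours_def arcs_symmetric)
    then have "c' v = 1"
      using lt by (auto simp: c'_def)
    moreover have "c w = c v" if "w \<in> neighbours G u" for w
    proof -
      have "card (c ` neighbours G u) \<le> Suc 0"
        using one in_arcsD1[OF uv] by simp
      then have "\<forall>x\<in>c ` neighbours G u. \<forall>y\<in>c ` neighbours G u. x = y"
        by (simp only: card_le_Suc0_iff_eq finite_imageI finite_neighbours)
      then show ?thesis
        using that \<open>v \<in> neighbours G u\<close> by blast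
    qed
    ultimately show ?thesis
      using lt by (auto simp: c'_def)
  qed
  have "c' u \<noteq> c' v" if "(u, v) \<in> parcs G" for u v
  proof -
    have "c u \<noteq> c v"
      using assms(1) that by (auto simp: proper_colouring_def)
    then show ?thesis
      using main[of u v] main[of v u] that arcs_symmetric by (metis linorder_neqE_nat)
  qed
  then have "proper_colouring G 2 c'"
    by (auto simp: proper_colouring_def c'_def)
  then show ?thesis
    by blast
qed

lemma locally_few_colours_recolouring:
  assumes c: "proper_colouring G (2 ^ m) c"
    and few: "\<forall>v\<in>pverts G. card (c ` neighbours G v) \<le> r"
    and "r \<le> m" and "real (m choose r) * 2 ^ r * (1 - 1 / 2 ^ r) ^ t < 1"
  shows "\<exists>c'. proper_colouring G t c'"
proof -
  obtain X :: "nat \<Rightarrow> nat set"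
    where X: "\<And>S p. S \<subseteq> {..<m} \<Longrightarrow> card S \<le> r \<Longrightarrow> \<exists>i<t. \<forall>j\<in>S. j \<in> X i \<longleftrightarrow> p j"
    using ex_independent_family[OF assms(3,4)] by blast
  \<comment> \<open>As an image of the colours seen by \<open>v\<close>, this set has at most
    \<open>r\<close> elements. Adjacent vertices have distinct colours, so the unspecified value of
    \<open>first_diff\<close> at equal arguments never enters.\<close>
  define D where "D v = first_diff (c v) ` c ` neighbours G v" for v
  have "\<exists>i<t. \<forall>j\<in>D v. j \<in> X i \<longleftrightarrow> bit (c v) j" if v: "v \<in> pverts G" for v
  proof (rule X)
    show "D v \<subseteq> {..<m}"
    proof
      fix j assume "j \<in> D v"
      then obtain w where w: "(v, w) \<in> parcs G" "j = first_diff (c v) (c w)"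
        by (auto simp: D_def neighbours_def)
      with c v in_arcsD2[OF w(1)] show "j \<in> {..<m}"
        by (auto simp: proper_colouring_def intro!: first_diff_less)
    qed
    have "card (D v) \<le> card (c ` neighbours G v)"
      unfolding D_def by (rule card_image_le) (simp add: finite_neighbours)
    with few v show "card (D v) \<le> r"
      by (meson order_trans)
  qed
  then obtain c' where c': "\<And>v. v \<in> pverts G \<Longrightarrow> c' v < t"
    "\<And>v j. v \<in> pverts G \<Longrightarrow> j \<in> D v \<Longrightarrow> j \<in> X (c' v) \<longleftrightarrow> bit (c v) j"
    by metis
  have "c' u \<noteq> c' v" if uv: "(u, v) \<in> parcs G" for u v
  proof
    assume eq: "c' u = c' v"
    let ?j = "first_diff (c u) (c v)"
    have "?j \<in> D u" "?j \<in> D v"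
      using uv by (auto simp: D_def neighbours_def arcs_symmetric first_diff_commute[of "c u"])
    then have "bit (c u) ?j = bit (c v) ?j"
      using c'(2) in_arcsD1[OF uv] in_arcsD2[OF uv] eq by metis
    moreover have "c u \<noteq> c v"
      using c uv by (auto simp: proper_colouring_def)
    ultimately show False
      using bit_first_diff by blast
  qed
  with c'(1) show ?thesis
    by (auto simp: proper_colouring_def)
qed

end

section \<open>Colourings under extra colours and homomorphisms\<close>

lemma chromatic_number_le: "proper_colouring G k c \<Longrightarrow> chromatic_number G \<le> k"
  unfolding chromatic_number_def by (rule Least_le) blast

lemma proper_colouring_mono: "proper_colouring G k c \<Longrightarrow> k \<le> l \<Longrightarrow> proper_colouring G l c"
  by (auto simp: proper_colouring_def)

lemma proper_colouring_graph_hom: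
  "proper_colouring G k c \<Longrightarrow> graph_hom H G \<phi> \<Longrightarrow> proper_colouring H k (c \<circ> \<phi>)"
  by (auto simp: proper_colouring_def graph_hom_def)

section \<open>Numerical estimates for the union bound\<close>

lemma binomial_fact_le:
  assumes "0 < r" "0 < m"
  shows "(m choose r) * fact r \<le> m * (m - 1) ^ (r - 1)"
proof -
  obtain a b where ab: "m = Suc a" "r = Suc b"
    using assms by (metis Suc_pred)
  have "(m choose r) * fact r = Suc b * (Suc a choose Suc b) * fact b"
    by (simp only: ab fact_Suc of_nat_id ac_simps)
  also have "\<dots> = m * ((a choose b) * fact b)"
    by (simp only: Suc_times_binomial ab ac_simps)
  \<comment> \<open>Bounding all factors but the first by \<open>m - 1\<close> pays off for
    \<open>m \<le> L + 1\<close>: those factors are then at most \<open>L\<close>.\<close>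
  also have "\<dots> \<le> m * a ^ b"
    by (intro mult_left_mono binomial_fact_pow) auto
  finally show ?thesis
    by (simp add: ab)
qed

text \<open>This lets the factor \<open>2 ^ r\<close> of the union bound be absorbed by the
  \<open>fact r\<close> in the denominator of the binomial coefficient.\<close>

lemma two_power_le_fact: "1 \<le> r \<Longrightarrow> (2::real) ^ r \<le> 2 * fact r"
proof (induction r rule: dec_induct)
  case (step k)
  then have "2 * 2 ^ k \<le> real (Suc k) * (2 * fact k)"
    by (intro mult_mono) auto
  then show ?case
    by (simp add: algebra_simps)
qed simp

text \<open>From \<open>1 - x \<le> exp (- x)\<close> the power is at most
  \<open>exp (- t / 2 ^ r)\<close>, and \<open>ln 2 \<le> 25 / 36\<close> turns the binary logarithm
  in the bound on \<open>t\<close> into at least \<open>36 / 25 * ln L\<close>.\<close>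

lemma one_minus_power_le_powr:
  fixes L :: real
  assumes "1 \<le> L" and t: "real r * 2 ^ r * log 2 L \<le> real t"
  shows "(1 - 1 / 2 ^ r) ^ t \<le> L powr (- (36 / 25 * real r))"
proof -
  have "36 / 25 * ln L \<le> log 2 L"
    using ln2_le_25_over_36 ln_ge_zero[OF assms(1)] mult_right_mono[of "ln 2" "25/36" "ln L"]
    by (simp add: log_def field_simps)
  then have "36 / 25 * real r * ln L \<le> real r * log 2 L"
    using mult_left_mono[of _ _ "real r"] by (simp add: mult.assoc mult.left_commute)
  also have "\<dots> \<le> real t / 2 ^ r"
    using t by (simp add: field_simps)
  finally have *: "36 / 25 * real r * ln L \<le> real t / 2 ^ r" .
  have "(1 - 1 / 2 ^ r :: real) ^ t \<le> exp (- (1 / 2 ^ r)) ^ t"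
    using exp_ge_add_one_self[of "- (1 / 2 ^ r)"] by (intro power_mono) (auto simp: field_simps)
  also have "\<dots> = exp (- (real t / 2 ^ r))"
    by (simp flip: exp_of_nat_mult)
  also have "\<dots> \<le> exp (- (36 / 25 * real r) * ln L)"
    using * by simp
  also have "\<dots> = L powr (- (36 / 25 * real r))"
    using assms(1) by (simp add: powr_def)
  finally show ?thesis .
qed

text \<open>The number of pairs is at most \<open>50 / 19 * L ^ r\<close>, and the decay is
  \<open>L powr (- (36 / 25 * r))\<close>. The surplus \<open>L powr (11 / 25 * r)\<close> beats
  \<open>50 / 19\<close> already at \<open>r = 2\<close> and \<open>L = 19 / 6\<close>.\<close>

lemma union_bound_less_one:
  fixes L :: real
  assumes L: "19 / 6 \<le> L" and m: "0 < m" "real m \<le> L + 1" and r: "2 \<le> r"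
    and t: "real r * 2 ^ r * log 2 L \<le> real t"
  shows "real (m choose r) * 2 ^ r * (1 - 1 / 2 ^ r) ^ t < 1"
proof -
  have "real (m choose r) * 2 ^ r \<le> real (m choose r) * (2 * fact r)"
    using r by (intro mult_left_mono two_power_le_fact) auto
  also have "\<dots> = 2 * real ((m choose r) * fact r)"
    by simp
  also have "\<dots> \<le> 2 * real (m * (m - 1) ^ (r - 1))"
    using binomial_fact_le[of r m] m r by (intro mult_left_mono of_nat_mono) auto
  also have "\<dots> = 2 * (real m * (real m - 1) ^ (r - 1))"
    using m by (simp add: of_nat_diff)
  \<comment> \<open>Since \<open>L \<ge> 19 / 6\<close>, \<open>1 \<le> 6 / 19 * L\<close>, hence
    \<open>m \<le> L + 1 \<le> 25 / 19 * L\<close>.\<close>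
  also have "\<dots> \<le> 2 * (25 / 19 * L * L ^ (r - 1))"
    using m L by (intro mult_left_mono mult_mono power_mono) auto
  also have "\<dots> = 50 / 19 * L ^ r"
    using r by (simp add: power_eq_if)
  finally have count: "real (m choose r) * 2 ^ r \<le> 50 / 19 * L ^ r" .
  have "(50 / 19 :: real) < (19 / 6) powr (22 / 25)"
  proof -
    have "(50 / 19 :: real) ^ 25 < (19 / 6) ^ 22"
      by (simp add: power_divide)
    also have "\<dots> = ((19 / 6) powr (22 / 25)) ^ 25"
      by (simp add: powr_power)
    finally show ?thesis
      by (rule power_less_imp_less_base) simp
  qed
  also have "\<dots> \<le> L powr (22 / 25)"
    using L by (intro powr_mono2) auto
  also have "\<dots> \<le> L powr (11 / 25 * real r)"
    using L r by (intro powr_mono) auto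
  finally have "50 / 19 * L ^ r < L powr (11 / 25 * real r) * L powr (real r)"
    using L by (simp add: powr_realpow)
  also have "\<dots> = L powr (36 / 25 * real r)"
    by (simp flip: powr_add)
  finally have *: "real (m choose r) * 2 ^ r < L powr (36 / 25 * real r)"
    using count by simp
  have "real (m choose r) * 2 ^ r * (1 - 1 / 2 ^ r) ^ t
          \<le> real (m choose r) * 2 ^ r * L powr (- (36 / 25 * real r))"
    using one_minus_power_le_powr[OF _ t] L by (intro mult_left_mono) auto
  also have "\<dots> < L powr (36 / 25 * real r) * L powr (- (36 / 25 * real r))"
    using * L by (intro mult_strict_right_mono) auto
  also have "\<dots> = 1"
    using L by (simp flip: powr_add)
  finally show ?thesis .
qed

section \<open>Rational lower bounds for iterated logarithms\<close>

lemma le_log2I: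
  fixes x :: real
  assumes "0 < x" "0 < q" "2 ^ k \<le> x ^ q"
  shows "real k / real q \<le> log 2 x"
proof -
  have "log 2 (2 ^ k) \<le> log 2 (x ^ q)"
    using assms by (subst log_le_cancel_iff) auto
  then show ?thesis
    using assms by (simp add: log_nat_power field_simps)
qed

text \<open>It rests on \<open>2 ^ 3 \<le> 3 ^ 2\<close> and
  \<open>2 ^ 11 \<le> (3 / 2) ^ 20\<close>. A bound above 1/2 is what the case \<open>r = 1\<close>
  calls for: it makes \<open>2 * log 2 (log 2 n)\<close> exceed 1, so its ceiling is at least
  2.\<close>

lemma log2_log2_ge:
  fixes n :: real
  assumes "3 \<le> n"
  shows "11 / 20 \<le> log 2 (log 2 n)"
proof -
  have "3 / 2 \<le> log 2 (3 :: real)"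
    using le_log2I[of 3 2 3] by simp
  also have "\<dots> \<le> log 2 n"
    using assms by simp
  finally have *: "3 / 2 \<le> log 2 n" .
  have "11 / 20 \<le> log 2 (3 / 2 :: real)"
    using le_log2I[of "3 / 2" 20 11] by (simp add: power_divide)
  also have "\<dots> \<le> log 2 (log 2 n)"
    using * by simp
  finally show ?thesis .
qed

section \<open>The bound, by cases on \<open>r\<close> and the chromatic number of
  \<open>G\<close>\<close>

theorem theorem1p1:
  fixes G :: "'a pair_pre_digraph" and H :: "'b pair_pre_digraph"
    and \<phi> :: "'b \<Rightarrow> 'a" and r :: nat
  assumes "pair_graph G" and "pair_graph H"
    and "chromatic_number G > 2"
    and "graph_hom H G \<phi>"
    and "r \<ge> 1"
    and "\<forall>v \<in> pverts H. card (\<phi> ` neighbours H v) \<le> r"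
  shows "int (chromatic_number H)
           \<le> \<lceil>real r * 2 ^ r * log 2 (log 2 (real (chromatic_number G)))\<rceil>"
proof -
  interpret G: pair_graph G by fact
  interpret H: pair_graph H by fact
  define n where "n = chromatic_number G"
  define L where "L = log 2 (real n)"
  define t where "t = nat \<lceil>real r * 2 ^ r * log 2 L\<rceil>"
  have n: "3 \<le> n"
    using assms(3) by (simp add: n_def)
  have L: "11 / 20 \<le> log 2 L"
    using log2_log2_ge[of "real n"] n by (simp add: L_def)
  have t: "real r * 2 ^ r * log 2 L \<le> real t"
    unfolding t_def by (rule real_nat_ceiling_ge)
  obtain c where "proper_colouring G n c"
    using G.ex_colouring_chromatic_number by (auto simp: n_def)
  then have c: "proper_colouring H n (c \<circ> \<phi>)"
    using assms(4) by (rule proper_colouring_graph_hom)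
  have few: "\<forall>v\<in>pverts H. card ((c \<circ> \<phi>) ` neighbours H v) \<le> r"
  proof
    fix v assume "v \<in> pverts H"
    have "card ((c \<circ> \<phi>) ` neighbours H v) \<le> card (\<phi> ` neighbours H v)"
      unfolding image_comp[symmetric]
      by (rule card_image_le) (simp add: H.finite_neighbours)
    with assms(6) \<open>v \<in> pverts H\<close> show "card ((c \<circ> \<phi>) ` neighbours H v) \<le> r"
      by (meson order_trans)
  qed
  have "\<exists>c'. proper_colouring H t c'"
  proof (cases "r = 1")
    case True
    with t L have "2 \<le> t"
      by simp
    then show ?thesis
      using H.locally_one_colour_imp_2_colourable[OF c] few True proper_colouring_mono by blast
  next
    case False
    then have r: "2 \<le> r"
      using assms(5) by simp
    have "2 * 2 ^ 2 \<le> real r * 2 ^ r"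
      using r by (intro mult_mono power_increasing) auto
    then have r8: "8 \<le> real r * 2 ^ r"
      by simp
    have small: "8 * log 2 L \<le> real t"
      using mult_right_mono[OF r8, of "log 2 L"] L t by linarith
    have large: "real r * 2 ^ r \<le> real t" if "4 \<le> n"
    proof -
      have "2 \<le> L"
        using that by (simp add: L_def le_log_iff)
      then have "1 \<le> log 2 L"
        by (simp add: le_log_iff)
      then have "real r * 2 ^ r * 1 \<le> real r * 2 ^ r * log 2 L"
        by (intro mult_left_mono) auto
      with t show ?thesis
        by simp
    qed
    define m where "m = nat \<lceil>L\<rceil>"
    have "L > 0"
      using n by (simp add: L_def)
    have "real n = 2 powr L"
      using n by (simp add: L_def)
    also have "\<dots> \<le> 2 powr (real m)"
      unfolding m_def by (intro powr_mono real_nat_ceiling_ge) auto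
    finally have nm: "n \<le> 2 ^ m"
      by (simp add: powr_realpow)
    \<comment> \<open>In the first three cases \<open>n \<le> t\<close>, so the pulled-back
      colouring suffices: \<open>8 * 11 / 20 > 3\<close> for \<open>n = 3\<close>,
      \<open>r * 2 ^ r \<ge> 8\<close> for \<open>n \<le> 8\<close>, and
      \<open>n \<le> 2 ^ m \<le> 2 ^ r\<close> when \<open>m \<le> r\<close>.\<close>
    consider "n = 3" | "4 \<le> n" "n \<le> 8" | "4 \<le> n" "m \<le> r" | "9 \<le> n" "r \<le> m"
      using n by linarith
    then show ?thesis
    proof cases
      case 1
      with L small have "n \<le> t"
        by linarith
      with c proper_colouring_mono show ?thesis by blast
    next
      case 2
      with large r8 have "n \<le> t"
        by linarith
      with c proper_colouring_mono show ?thesis by blast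
    next
      case 3
      have "real n \<le> 2 ^ m"
        using nm by simp
      also have "\<dots> \<le> 1 * 2 ^ r"
        using 3 by simp
      also have "\<dots> \<le> real r * 2 ^ r"
        using r by (intro mult_right_mono) auto
      also have "\<dots> \<le> real t"
        using large 3 by simp
      finally have "n \<le> t"
        by simp
      with c proper_colouring_mono show ?thesis by blast
    next
      case 4
      \<comment> \<open>This is \<open>2 ^ 19 = 524288 \<le> 531441 = 9 ^ 6\<close>.\<close>
      have "19 / 6 \<le> log 2 (9 :: real)"
        using le_log2I[of 9 6 19] by simp
      also have "\<dots> \<le> L"
        using 4 by (simp add: L_def)
      finally have "19 / 6 \<le> L" .
      moreover have "0 < m" "real m \<le> L + 1"
        using \<open>L > 0\<close> by (auto simp: m_def)
      ultimately have "real (m choose r) * 2 ^ r * (1 - 1 / 2 ^ r) ^ t < 1"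
        using r t by (rule union_bound_less_one)
      with H.locally_few_colours_recolouring[OF proper_colouring_mono[OF c nm] few] 4
      show ?thesis by blast
    qed
  qed
  then have "chromatic_number H \<le> t"
    using chromatic_number_le by blast
  \<comment> \<open>Nonnegativity ensures that \<open>nat\<close> in the definition of
    \<open>t\<close> does not alter the ceiling.\<close>
  moreover have "0 \<le> real r * 2 ^ r * log 2 L"
    using L by simp
  ultimately show ?thesis
    unfolding t_def L_def n_def by linarith
qed

end
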